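(* Let $H$ be a unicyclic finite simple graph with $|V(H)|=n$ whose girth $m$ is odd, let $G=W(H)$ be the whisker graph of $H$, let $\mathbb{K}$ be a field, and let $R=\mathbb{K}[V(G)]$ be the polynomial ring whose variables are the vertices of $G$. Then $$\operatorname{depth}\bigl(R/I(G)^{[q]}\bigr)\le n+q-1-\Big\lfloor\frac m2\Big\rfloor\quad\text{for all integers } q \text{ with } \Big\lceil\frac m2\Big\rceil\le q\le n-\Big\lfloor\frac m2\Big\rfloor.$$
   Context: A graph is unicyclic if it is connected and contains exactly one cycle; its girth is then the length of that cycle. For a finite simple graph $H$ with vertices $x_1,\dots,x_n$, the whisker graph $W(H)$ has vertex set $\{x_1,\dots,x_n,y_1,\dots,y_n\}$ (the $y_i$ being new vertices) and edge set $E(H)\cup\{\{x_i,y_i\}: 1\le i\le n\}$. For $q\ge1$, the $q$-th squarefree power $I(G)^{[q]}\subseteq R$ of the edge ideal is the ideal generated by the monomials $\prod_{x\in e_1\cup\cdots\cup e_q}x$ where $e_1,\dots,e_q$ are pairwise disjoint edges of $G$. *)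

theory Defs
  imports "HOL-Library.Poly_Mapping" "HOL-Library.Extended_Nat" "HOL-Library.Cardinality"
begin

text \<open>A simple graph on the vertex set \<open>UNIV :: 'v set\<close> is given by its set of edges,
  each edge being a set of two vertices. Finiteness comes from the class of \<open>'v\<close>.\<close>

definition simple_graph :: "'v set set \<Rightarrow> bool" where
  "simple_graph E \<longleftrightarrow> (\<forall>e\<in>E. card e = 2)"

definition connected_graph :: "'v set set \<Rightarrow> bool" where
  "connected_graph E \<longleftrightarrow> (\<forall>u v. (u, v) \<in> {(x, y). {x, y} \<in> E}\<^sup>*)"

definition closed_walk_edges :: "'v list \<Rightarrow> 'v set set" where
  "closed_walk_edges xs = {{xs ! i, xs ! (Suc i mod length xs)} | i. i < length xs}"

text \<open>A cycle is a subgraph, here identified with its edge set, so that the same cycle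
  traversed from another starting vertex or in the other direction is counted only once.\<close>

definition is_cycle :: "'v set set \<Rightarrow> 'v set set \<Rightarrow> bool" where
  "is_cycle E C \<longleftrightarrow>
     C \<subseteq> E \<and> (\<exists>xs. distinct xs \<and> 3 \<le> length xs \<and> C = closed_walk_edges xs)"

definition unicyclic :: "'v set set \<Rightarrow> bool" where
  "unicyclic E \<longleftrightarrow> connected_graph E \<and> (\<exists>!C. is_cycle E C)"

text \<open>Only meaningful for unicyclic graphs; the length of a cycle is its number of edges.\<close>

definition unicyclic_girth :: "'v set set \<Rightarrow> nat" where
  "unicyclic_girth E = card (THE C. is_cycle E C)"

text \<open>The vertex \<open>x\<close> of the original graph becomes \<open>Inl x\<close>; its whisker ends in \<open>Inr x\<close>.\<close>

definition whisker_graph :: "'v set set \<Rightarrow> ('v + 'v) set set" where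
  "whisker_graph E = (\<lambda>e. Inl ` e) ` E \<union> range (\<lambda>x. {Inl x, Inr x})"

text \<open>Polynomials over \<open>'k\<close> in the variables \<open>'v\<close>: finitely supported maps from exponent
  vectors to coefficients, with the ring structure of \<^theory>\<open>HOL-Library.Poly_Mapping\<close>.\<close>

type_synonym ('v, 'k) mpoly = "('v \<Rightarrow>\<^sub>0 nat) \<Rightarrow>\<^sub>0 'k"

definition indet :: "'v \<Rightarrow> ('v, 'k::comm_ring_1) mpoly" where
  "indet x = Poly_Mapping.single (Poly_Mapping.single x 1) 1"

lemma module_times: "module ((*) :: 'a \<Rightarrow> 'a \<Rightarrow> 'a::comm_ring_1)"
  by unfold_locales (simp_all add: algebra_simps)

text \<open>Ideals are the submodules of the ring regarded as a module over itself.\<close>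

abbreviation ideal_of :: "'a::comm_ring_1 set \<Rightarrow> 'a set" where
  "ideal_of \<equiv> module.span (*)"

definition squarefree_power :: "'v set set \<Rightarrow> nat \<Rightarrow> ('v, 'k::comm_ring_1) mpoly set" where
  "squarefree_power E q =
     ideal_of {(\<Prod>x\<in>\<Union>M. indet x) | M.
       M \<subseteq> E \<and> finite M \<and> card M = q \<and> pairwise disjnt M}"

text \<open>For an ideal \<open>I\<close>, a sequence \<open>f\<^sub>1, \<dots>, f\<^sub>r\<close> of ring elements is regular on \<open>M = R/I\<close>
  if each \<open>f\<^sub>i\<close> is a nonzerodivisor on \<open>M/(f\<^sub>1, \<dots>, f\<^sub>i\<^sub>-\<^sub>1)M = R/(I + (f\<^sub>1, \<dots>, f\<^sub>i\<^sub>-\<^sub>1))\<close>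
  and \<open>M/(f\<^sub>1, \<dots>, f\<^sub>r)M\<close> is not zero.\<close>

definition regular_on_quotient :: "'a::comm_ring_1 set \<Rightarrow> 'a list \<Rightarrow> bool" where
  "regular_on_quotient I fs \<longleftrightarrow>
     (\<forall>i<length fs. \<forall>g. fs ! i * g \<in> ideal_of (I \<union> set (take i fs))
        \<longrightarrow> g \<in> ideal_of (I \<union> set (take i fs)))
     \<and> ideal_of (I \<union> set fs) \<noteq> UNIV"

text \<open>The depth of \<open>R/I\<close> with respect to the graded maximal ideal \<open>(x | x a variable)\<close>: the
  supremum of the lengths of the \<open>R/I\<close>-regular sequences in that ideal. The elements of the
  sequence need not be homogeneous. The zero module has depth \<open>\<infinity>\<close>.\<close>

definition depth_quotient :: "('v, 'k::comm_ring_1) mpoly set \<Rightarrow> enat" where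
  "depth_quotient I =
     (if I = UNIV then \<infinity>
      else SUP fs \<in> {fs. set fs \<subseteq> ideal_of (range indet) \<and> regular_on_quotient I fs}.
             enat (length fs))"

end

theory Submission
  imports Defs "HOL-Library.FuncSet"
begin

text \<open>
  Let \<open>k = m div 2\<close>, so that the cycle \<open>C\<close> of \<open>H\<close> has \<open>2k + 1\<close> vertices, and let \<open>T\<close> be a set of
  \<open>q - 1 - k\<close> vertices outside \<open>C\<close>. In the whisker graph consider the vertex set \<open>S\<close> that consists of
  the vertices in \<open>C \<union> T\<close> and of the whisker ends at all vertices outside \<open>C\<close>; it has
  \<open>n + q - 1 - k\<close> elements. Every edge inside \<open>S\<close> meets \<open>T\<close> or lies in \<open>C\<close>, so a matching inside
  \<open>S\<close> has at most \<open>card T + k = q - 1\<close> edges. But \<open>S\<close> is maximal with this property: an odd cycle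
  without an arbitrary vertex \<open>x\<close> is perfectly matched by \<open>k\<close> edges, and adding to \<open>S\<close>
  a missing vertex (either a vertex of \<open>H\<close> outside \<open>C \<union> T\<close> or the whisker end at a vertex of \<open>C\<close>)
  makes room for one more whisker. Hence the product \<open>h\<close> of the variables in \<open>S\<close> is not in \<open>I = I(G)\<^sup>[\<^sup>q\<^sup>]\<close>, but all of its
  multiples by variables outside \<open>S\<close> are: the annihilator of \<open>h\<close> in \<open>R/I\<close> is the prime ideal \<open>P\<close>
  generated by those variables, and \<open>R/P\<close> is a polynomial ring in \<open>card S\<close> variables.

  It remains to see that the depth of \<open>R/I\<close> is at most \<open>card S\<close>, an instance of the inequality
  \<open>depth M \<le> dim R/P\<close> for associated primes. Suppose that \<open>f\<^sub>1, \<dots>, f\<^sub>r\<close> is a regular sequence in the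
  maximal ideal with \<open>r > card S\<close>. Counting monomials in \<open>R/P\<close> gives a nonzero polynomial \<open>F\<close> with
  constant coefficients such that \<open>F(f\<^sub>1, \<dots>, f\<^sub>r) \<in> P\<close>, that is, \<open>F(f) h \<in> I\<close>. A regular sequence is
  quasi-regular: with \<open>J = (f\<^sub>1, \<dots>, f\<^sub>r)\<close> and \<open>M = R/I\<close>, the graded module of the filtration
  \<open>J\<^sup>s M\<close> is a polynomial module over \<open>M/JM\<close>, on which the lowest form of \<open>F\<close> acts injectively. So
  \<open>F(f) h \<in> I\<close> forces \<open>h\<close> into \<open>I + J\<^sup>s\<close> for all \<open>s\<close>. This is impossible, as \<open>h\<close> is a monomial outside
  the monomial ideal \<open>I\<close>, and \<open>J\<^sup>s\<close> has no terms of degree less than \<open>s\<close>.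

  The three ingredients are \<open>initial_nonzerodivisor_polynomial\<close> (quasi-regularity),
  \<open>algebraically_dependent_modulo\<close> (the counting) and \<open>depth_whisker_odd_cycle_le\<close> (the set \<open>S\<close>).
\<close>

section \<open>Filtrations by powers of an ideal\<close>

interpretation ideal: module "(*) :: 'a \<Rightarrow> 'a \<Rightarrow> 'a::comm_ring_1"
  by (rule module_times)

text \<open>As a rewrite rule, this instance of associativity would loop with \<open>mult.assoc\<close>.\<close>

declare ideal.scale_scale [simp del]

abbreviation is_ideal :: "'a::comm_ring_1 set \<Rightarrow> bool" where
  "is_ideal \<equiv> module.subspace (*)"

text \<open>This is the ideal \<open>I + (F)\<^sup>s B\<close>. The recursion multiplies by one generator at a time, so that
  products of powers become iterated applications. The argument \<open>B\<close> matters for gradings: if \<open>B\<close> is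
  an ideal that contains \<open>I\<close> and \<open>F\<close>, then membership of a form of degree \<open>s\<close> in \<open>adic I F s B\<close>
  says that its coefficients can be chosen in \<open>B\<close>, and \<open>B = I + (F)\<close> gives the next power of \<open>(F)\<close>.\<close>

fun adic :: "'a::comm_ring_1 set \<Rightarrow> 'a set \<Rightarrow> nat \<Rightarrow> 'a set \<Rightarrow> 'a set" where
  "adic I F 0 B = ideal_of (I \<union> B)"
| "adic I F (Suc s) B = ideal_of (I \<union> {f * g | f g. f \<in> F \<and> g \<in> adic I F s B})"

declare adic.simps [simp del]

lemma is_ideal_adic [simp]: "is_ideal (adic I F s B)"
  by (cases s) (auto simp: adic.simps)

lemma base_subset_adic: "I \<subseteq> adic I F s B"
  by (cases s) (auto simp: adic.simps intro: ideal.span_base)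

lemma adic_0_ideal:
  assumes "is_ideal B" "I \<subseteq> B"
  shows "adic I F 0 B = B"
proof -
  have "I \<union> B = B" using assms(2) by auto
  then show ?thesis using assms(1) by (simp add: adic.simps)
qed

lemma adic_0_UNIV [simp]: "adic I F 0 UNIV = UNIV"
  by (simp add: adic.simps)

lemma adic_gen_times: "f \<in> F \<Longrightarrow> g \<in> adic I F s B \<Longrightarrow> f * g \<in> adic I F (Suc s) B"
  by (auto simp: adic.simps intro!: ideal.span_base)

lemma adic_mono: "F \<subseteq> F' \<Longrightarrow> B \<subseteq> B' \<Longrightarrow> adic I F s B \<subseteq> adic I F' s B'"
proof (induction s)
  case 0
  then show ?case unfolding adic.simps by (intro ideal.span_mono) blast
next
  case (Suc s)
  then show ?case unfolding adic.simps by (intro ideal.span_mono) blast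
qed

lemma adic_adic: "adic I F s (adic I F t B) = adic I F (s + t) B"
proof (induction s)
  case 0
  show ?case using adic_0_ideal[OF is_ideal_adic base_subset_adic] by simp
qed (simp add: adic.simps)

lemma ideal_of_leI: "X \<subseteq> T \<Longrightarrow> is_ideal T \<Longrightarrow> ideal_of X \<subseteq> T"
  by (rule ideal.span_minimal)

lemma adic_Suc_UNIV: "adic I F (Suc s) UNIV = adic I F s (ideal_of (I \<union> F))"
proof -
  have "adic I F 1 UNIV = ideal_of (I \<union> F)"
  proof
    show "adic I F 1 UNIV \<subseteq> ideal_of (I \<union> F)"
    proof -
      have "g * f \<in> ideal_of (I \<union> F)" if "f \<in> F" for f g
        using that by (simp add: ideal.span_base ideal.span_scale)
      then have "f * g \<in> ideal_of (I \<union> F)" if "f \<in> F" for f g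
        using that by (metis mult.commute)
      then show ?thesis unfolding One_nat_def adic.simps(2)
        by (intro ideal_of_leI) (auto intro: ideal.span_base)
    qed
    show "ideal_of (I \<union> F) \<subseteq> adic I F 1 UNIV"
    proof (rule ideal_of_leI)
      show "I \<union> F \<subseteq> adic I F 1 UNIV"
        using base_subset_adic[of I F 1 UNIV] adic_gen_times[of _ F 1 I 0 UNIV] by auto
    qed simp
  qed
  then show ?thesis using adic_adic[of I F s 1 UNIV] by simp
qed

lemma adic_Suc_subset: "adic I F (Suc s) B \<subseteq> adic I F s B"
proof (induction s)
  case 0
  show ?case unfolding adic.simps
    by (rule ideal_of_leI) (auto intro: ideal.span_base ideal.span_scale)
next
  case (Suc s)
  then show ?case by (subst (1 2) adic.simps(2)) (intro ideal.span_mono, blast)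
qed

lemma adic_times:
  assumes "p \<in> adic I F d UNIV" "h \<in> adic I F s B"
  shows "p * h \<in> adic I F (d + s) B"
  using assms
proof (induction d arbitrary: p)
  case 0
  then show ?case by (simp add: ideal.subspace_scale)
next
  case (Suc d)
  have "adic I F (Suc d) UNIV \<subseteq> {p. p * h \<in> adic I F (Suc d + s) B}"
    unfolding adic.simps(2)[of I F d]
  proof (rule ideal_of_leI)
    show "I \<union> {f * g |f g. f \<in> F \<and> g \<in> adic I F d UNIV} \<subseteq> {p. p * h \<in> adic I F (Suc d + s) B}"
    proof (rule subsetI, elim UnE)
      fix x assume "x \<in> I"
      then have "x \<in> adic I F (Suc d + s) B" using base_subset_adic by blast
      then show "x \<in> {p. p * h \<in> adic I F (Suc d + s) B}"
        using ideal.subspace_scale[OF is_ideal_adic, of x I F "Suc d + s" B h] by (simp add: mult.commute)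
    next
      fix x assume "x \<in> {f * g |f g. f \<in> F \<and> g \<in> adic I F d UNIV}"
      then obtain f g where fg: "x = f * g" "f \<in> F" "g \<in> adic I F d UNIV" by blast
      have "f * (g * h) \<in> adic I F (Suc (d + s)) B"
        by (rule adic_gen_times[OF fg(2) Suc.IH[OF fg(3) Suc.prems(2)]])
      then show "x \<in> {p. p * h \<in> adic I F (Suc d + s) B}"
        by (simp only: mem_Collect_eq fg(1) mult.assoc add_Suc)
    qed
    show "is_ideal {p. p * h \<in> adic I F (Suc d + s) B}"
      by (rule ideal.subspaceI)
        (simp_all only: mem_Collect_eq distrib_right mult.assoc mult_zero_left
          ideal.subspace_add[OF is_ideal_adic] ideal.subspace_scale[OF is_ideal_adic]
          ideal.subspace_0[OF is_ideal_adic])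
  qed
  then show ?case using Suc.prems by blast
qed

lemma adic_ideal_times:
  assumes "is_ideal B" "f \<in> B" "h \<in> adic I F s UNIV"
  shows "f * h \<in> adic I F s B"
proof -
  have "h * f \<in> adic I F (s + 0) B"
    by (rule adic_times) (use assms in \<open>auto simp: adic.simps intro: ideal.span_base\<close>)
  then show ?thesis by (simp add: mult.commute)
qed

text \<open>A form of positive degree in the elements of \<open>F\<close> and \<open>a\<close> is a form free of \<open>a\<close> plus a multiple of
  \<open>a\<close>. All inductions on the number of elements below split forms in this way.\<close>

lemma adic_insert_decompose:
  assumes "h \<in> adic I (insert a F) (Suc s) B"
  shows "\<exists>z \<in> adic I F (Suc s) B. \<exists>w \<in> adic I (insert a F) s B. h = z + a * w"
proof -
  define T where
    "T s = {z + a * w | z w. z \<in> adic I F (Suc s) B \<and> w \<in> adic I (insert a F) s B}" for s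
  have T: "is_ideal (T s)" for s
    unfolding ideal.subspace_def
  proof (intro conjI ballI allI)
    have "0 + a * 0 \<in> T s"
      unfolding T_def using ideal.subspace_0[OF is_ideal_adic] by blast
    then show "0 \<in> T s" by simp
  next
    fix x y assume "x \<in> T s" "y \<in> T s"
    then obtain z w z' w' where *: "x = z + a * w" "y = z' + a * w'"
      and "z + z' \<in> adic I F (Suc s) B" "w + w' \<in> adic I (insert a F) s B"
      unfolding T_def using ideal.subspace_add[OF is_ideal_adic] by blast
    moreover have "x + y = (z + z') + a * (w + w')" by (simp add: * algebra_simps)
    ultimately show "x + y \<in> T s" unfolding T_def by blast
  next
    fix c x assume "x \<in> T s"
    then obtain z w where *: "x = z + a * w"
      and "c * z \<in> adic I F (Suc s) B" "c * w \<in> adic I (insert a F) s B"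
      unfolding T_def using ideal.subspace_scale[OF is_ideal_adic] by blast
    moreover have "c * x = (c * z) + a * (c * w)" by (simp add: * algebra_simps)
    ultimately show "c * x \<in> T s" unfolding T_def by blast
  qed
  have left: "z \<in> T s" if "z \<in> adic I F (Suc s) B" for z s
  proof -
    have "z + a * 0 \<in> T s"
      unfolding T_def using that ideal.subspace_0[OF is_ideal_adic] by blast
    then show ?thesis by simp
  qed
  have right: "a * w \<in> T s" if "w \<in> adic I (insert a F) s B" for w s
  proof -
    have "0 + a * w \<in> T s"
      unfolding T_def using that ideal.subspace_0[OF is_ideal_adic] by blast
    then show ?thesis by simp
  qed
  have "adic I (insert a F) (Suc s) B \<subseteq> T s" for s
  proof (induction s)
    case 0
    show ?case unfolding adic.simps(2)
    proof (rule ideal_of_leI[OF _ T], rule subsetI, elim UnE)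
      fix x assume "x \<in> I"
      then show "x \<in> T 0" using left base_subset_adic by blast
    next
      fix x assume "x \<in> {f * g |f g. f \<in> insert a F \<and> g \<in> adic I (insert a F) 0 B}"
      then obtain f g where "x = f * g" "f \<in> insert a F" "g \<in> adic I (insert a F) 0 B" by auto
      then show "x \<in> T 0"
        using left[OF adic_gen_times[of f F g I 0 B]] right[of g 0] by (auto simp: adic.simps(1))
    qed
  next
    case (Suc s)
    show ?case unfolding adic.simps(2)[of I "insert a F" "Suc s"]
    proof (rule ideal_of_leI[OF _ T], rule subsetI, elim UnE)
      fix x assume "x \<in> I"
      then show "x \<in> T (Suc s)" using left base_subset_adic by blast
    next
      fix x assume "x \<in> {f * g |f g. f \<in> insert a F \<and> g \<in> adic I (insert a F) (Suc s) B}"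
      then obtain f g where fg: "x = f * g" "f \<in> insert a F" "g \<in> adic I (insert a F) (Suc s) B"
        by blast
      show "x \<in> T (Suc s)"
      proof (cases "f = a")
        case True
        then show ?thesis using right fg by blast
      next
        case False
        obtain z w where zw: "g = z + a * w" "z \<in> adic I F (Suc s) B" "w \<in> adic I (insert a F) s B"
          using Suc fg(3) unfolding T_def by blast
        have "f * z \<in> T (Suc s)" using False fg(2) zw(2) adic_gen_times left by blast
        moreover have "a * (f * w) \<in> T (Suc s)"
          using right adic_gen_times[OF fg(2) zw(3)] by blast
        moreover have "x = f * z + a * (f * w)" by (simp add: fg(1) zw(1) algebra_simps)
        ultimately show ?thesis using ideal.subspace_add[OF T] by simp
      qed
    qed
  qed
  then show ?thesis using assms unfolding T_def by blast
qed

section \<open>Regular sequences are quasi-regular\<close>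

text \<open>A nonzerodivisor modulo \<open>I + (F)\<^sup>j\<close> for all \<open>j\<close>, not only for \<open>j = 1\<close>.\<close>

definition adic_nonzerodivisor :: "'a::comm_ring_1 set \<Rightarrow> 'a set \<Rightarrow> 'a \<Rightarrow> bool" where
  "adic_nonzerodivisor I F a \<longleftrightarrow>
     (\<forall>j g. a * g \<in> adic I F j UNIV \<longrightarrow> g \<in> adic I F j UNIV)"

text \<open>The element \<open>p\<close> has order at least \<open>d\<close> with respect to \<open>(F)\<close> on \<open>R/I\<close>, and multiplication by its
  degree \<open>d\<close> part is injective on the graded module whose component of degree \<open>s\<close> consists of the
  forms of degree \<open>s\<close> in \<open>F\<close> modulo those with coefficients in \<open>B\<close>. For \<open>B = I + (F)\<close> this is the
  associated graded module of \<open>R/I\<close>. Larger ideals \<open>B\<close> are needed for inductions that enlarge \<open>F\<close>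
  and keep \<open>B\<close> fixed.\<close>

definition initial_nonzerodivisor ::
    "'a::comm_ring_1 set \<Rightarrow> 'a set \<Rightarrow> 'a set \<Rightarrow> nat \<Rightarrow> 'a \<Rightarrow> bool" where
  "initial_nonzerodivisor I F B d p \<longleftrightarrow>
     p \<in> adic I F d UNIV \<and>
     (\<forall>s. \<forall>h \<in> adic I F s UNIV. p * h \<in> adic I F (s + d) B \<longrightarrow> h \<in> adic I F s B)"

lemma initial_nonzerodivisor_empty:
  assumes B: "is_ideal B" "I \<subseteq> B" and u: "\<And>g. u * g \<in> B \<Longrightarrow> g \<in> B"
  shows "initial_nonzerodivisor I {} B 0 u"
  unfolding initial_nonzerodivisor_def
proof (intro conjI allI ballI impI)
  fix s h assume h: "h \<in> adic I {} s UNIV" and uh: "u * h \<in> adic I {} (s + 0) B"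
  show "h \<in> adic I {} s B"
  proof (cases s)
    case 0
    then show ?thesis using uh u adic_0_ideal[OF B] by simp
  next
    case (Suc t)
    then show ?thesis using h by (simp add: adic.simps)
  qed
qed simp

lemma adic_Suc_UNIV_subset:
  assumes "is_ideal B" "I \<union> F \<subseteq> B"
  shows "adic I F (Suc s) UNIV \<subseteq> adic I F s B"
  unfolding adic_Suc_UNIV by (intro adic_mono ideal_of_leI assms order_refl)

lemma initial_nonzerodivisor_perturb:
  assumes "is_ideal B" "I \<union> F \<subseteq> B"
    and p: "initial_nonzerodivisor I F B d p" and r: "r \<in> adic I F (Suc d) UNIV"
  shows "initial_nonzerodivisor I F B d (r + p)"
  unfolding initial_nonzerodivisor_def
proof (intro conjI allI ballI impI)
  show "r + p \<in> adic I F d UNIV"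
    using p r adic_Suc_subset unfolding initial_nonzerodivisor_def
    by (blast intro: ideal.subspace_add[OF is_ideal_adic])
next
  fix s h assume h: "h \<in> adic I F s UNIV" and rph: "(r + p) * h \<in> adic I F (s + d) B"
  have "r * h \<in> adic I F (Suc (s + d)) UNIV"
    using adic_times[OF r h] by (simp add: add.commute)
  then have "r * h \<in> adic I F (s + d) B" using adic_Suc_UNIV_subset[OF assms(1,2)] by blast
  from ideal.subspace_diff[OF is_ideal_adic rph this]
  have "p * h \<in> adic I F (s + d) B" by (simp add: algebra_simps)
  then show "h \<in> adic I F s B" using p h unfolding initial_nonzerodivisor_def by blast
qed

text \<open>If \<open>a h = z + a w\<close> with \<open>z\<close> of degree \<open>s + 1\<close> in \<open>F\<close> alone, then \<open>a\<close> divides \<open>z\<close> within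
  \<open>(F)\<^sup>s\<^sup>+\<^sup>1\<close>, which is absorbed by the coefficients in \<open>B\<close>.\<close>

lemma adic_cancel_last:
  assumes B: "is_ideal B" "I \<union> insert a F \<subseteq> B"
    and C: "adic_nonzerodivisor I F a"
    and h: "a * h \<in> adic I (insert a F) (Suc s) B"
  shows "h \<in> adic I (insert a F) s B"
proof -
  obtain z w where z: "z \<in> adic I F (Suc s) B" and w: "w \<in> adic I (insert a F) s B"
    and eq: "a * h = z + a * w" using adic_insert_decompose[OF h] by blast
  have "a * (h - w) = z" using eq by (simp add: algebra_simps)
  also have "z \<in> adic I F (Suc s) UNIV" using z adic_mono[of F F B UNIV I "Suc s"] by blast
  finally have "h - w \<in> adic I F (Suc s) UNIV" using C unfolding adic_nonzerodivisor_def by blast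
  moreover have "adic I F (Suc s) UNIV \<subseteq> adic I F s B"
    by (rule adic_Suc_UNIV_subset) (use B in auto)
  moreover have "adic I F s B \<subseteq> adic I (insert a F) s B" by (rule adic_mono) auto
  ultimately have "h - w \<in> adic I (insert a F) s B" by blast
  from ideal.subspace_add[OF is_ideal_adic this w] show ?thesis by simp
qed

lemma initial_nonzerodivisor_times_last:
  assumes B: "is_ideal B" "I \<union> insert a F \<subseteq> B"
    and C: "adic_nonzerodivisor I F a"
    and p: "initial_nonzerodivisor I (insert a F) B d p"
  shows "initial_nonzerodivisor I (insert a F) B (Suc d) (a * p)"
  unfolding initial_nonzerodivisor_def
proof (intro conjI allI ballI impI)
  show "a * p \<in> adic I (insert a F) (Suc d) UNIV"
    using p unfolding initial_nonzerodivisor_def by (intro adic_gen_times) auto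
next
  fix s h assume h: "h \<in> adic I (insert a F) s UNIV"
    and "a * p * h \<in> adic I (insert a F) (s + Suc d) B"
  then have "a * (p * h) \<in> adic I (insert a F) (Suc (s + d)) B" by (simp add: mult.assoc)
  from adic_cancel_last[OF B C this] h show "h \<in> adic I (insert a F) s B"
    using p unfolding initial_nonzerodivisor_def by blast
qed

text \<open>The heart of the proof of quasi-regularity: of a form in the elements of \<open>F\<close> and \<open>a\<close>, the part
  \<open>p0\<close> that is free of \<open>a\<close> already decides injectivity. Write \<open>h = h0 + a h1\<close>. In \<open>p h\<close>, the part
  free of \<open>a\<close> is \<open>p0 h0\<close>; every other term is a multiple \<open>a y\<close>, and since \<open>a\<close> is a nonzerodivisor
  modulo powers of \<open>(F)\<close>, the factor \<open>y\<close> has the degree it ought to have. As \<open>a \<in> B\<close>, such terms vanish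
  modulo \<open>B\<close>, so \<open>h0\<close> has coefficients in \<open>B\<close>. Then \<open>a\<close> cancels from \<open>p a h1\<close>, and induction on the
  degree treats \<open>h1\<close>.\<close>

lemma initial_nonzerodivisor_insert:
  assumes B: "is_ideal B" "I \<union> insert a F \<subseteq> B"
    and C: "adic_nonzerodivisor I F a"
    and p0: "initial_nonzerodivisor I F B d p0"
    and p: "p0 + a * v \<in> adic I (insert a F) d UNIV"
  shows "initial_nonzerodivisor I (insert a F) B d (p0 + a * v)"
proof -
  let ?F = "insert a F" and ?p = "p0 + a * v"
  have aB: "a \<in> B" and IB: "I \<subseteq> B" using B(2) by auto
  have mono: "adic I F s B \<subseteq> adic I ?F s B" for s by (rule adic_mono) auto
  \<comment> \<open>The part of \<open>h\<close> that is free of \<open>a\<close> only meets \<open>p0\<close>.\<close>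
  have free: "h0 \<in> adic I F s B"
    if h0: "h0 \<in> adic I F s UNIV" and eq: "?p * (h0 + a * h1) \<in> adic I ?F (s + d) B" for s h0 h1
  proof -
    have ex: "\<exists>z \<in> adic I F (s + d) B. \<exists>w. ?p * (h0 + a * h1) = z + a * w"
    proof (cases "s + d")
      case 0
      then have "?p * (h0 + a * h1) \<in> adic I F (s + d) B"
        using eq adic_0_ideal[OF B(1) IB] by simp
      then show ?thesis by (metis add.right_neutral mult_zero_right)
    next
      case (Suc t)
      then show ?thesis using eq adic_insert_decompose[of _ I a F t B] by metis
    qed
    then obtain z w where z: "z \<in> adic I F (s + d) B" and zw: "?p * (h0 + a * h1) = z + a * w"
      by blast
    define y where "y = w - v * h0 - ?p * h1"
    have y: "p0 * h0 = z + a * y" using zw by (simp add: y_def algebra_simps)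
    have "p0 \<in> adic I F d UNIV" using p0 unfolding initial_nonzerodivisor_def by blast
    from adic_times[OF this h0] have "p0 * h0 \<in> adic I F (s + d) UNIV"
      by (simp add: add.commute)
    moreover have "z \<in> adic I F (s + d) UNIV" using z adic_mono[of F F B UNIV I] by blast
    ultimately have "p0 * h0 - z \<in> adic I F (s + d) UNIV"
      by (rule ideal.subspace_diff[OF is_ideal_adic])
    then have "a * y \<in> adic I F (s + d) UNIV" by (simp add: y)
    then have "y \<in> adic I F (s + d) UNIV" using C unfolding adic_nonzerodivisor_def by blast
    from adic_ideal_times[OF B(1) aB this]
    have "p0 * h0 \<in> adic I F (s + d) B"
      unfolding y using z ideal.subspace_add[OF is_ideal_adic] by blast
    then show ?thesis using p0 h0 unfolding initial_nonzerodivisor_def by blast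
  qed
  have "h \<in> adic I ?F s B" if "h \<in> adic I ?F s UNIV" "?p * h \<in> adic I ?F (s + d) B" for s h
    using that
  proof (induction s arbitrary: h)
    case 0
    have "h \<in> adic I F 0 B" by (rule free[of h 0 0]) (use 0 in auto)
    then show ?case using mono by blast
  next
    case (Suc s)
    obtain h0 h1 where h0: "h0 \<in> adic I F (Suc s) UNIV" and h1: "h1 \<in> adic I ?F s UNIV"
      and h: "h = h0 + a * h1" using adic_insert_decompose[OF Suc.prems(1)] by blast
    have h0': "h0 \<in> adic I ?F (Suc s) B"
      using free[OF h0] Suc.prems(2) mono unfolding h by blast
    from adic_times[OF p this] have "?p * h0 \<in> adic I ?F (Suc s + d) B" by (simp add: add.commute)
    from ideal.subspace_diff[OF is_ideal_adic Suc.prems(2) this]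
    have "a * (?p * h1) \<in> adic I ?F (Suc (s + d)) B" by (simp add: h algebra_simps)
    then have "?p * h1 \<in> adic I ?F (s + d) B" by (rule adic_cancel_last[OF B C])
    then have "h1 \<in> adic I ?F s B" using Suc.IH h1 by blast
    then have "a * h1 \<in> adic I ?F (Suc s) B" by (intro adic_gen_times) auto
    then show ?case unfolding h using h0' ideal.subspace_add[OF is_ideal_adic] by blast
  qed
  then show ?thesis using p unfolding initial_nonzerodivisor_def by blast
qed

text \<open>The lowest form of \<open>p + a q\<close> is that of \<open>p\<close>, possibly enlarged by multiples of \<open>a\<close>, if the order
  of \<open>p\<close> is at most that of \<open>a q\<close>, and it is that of \<open>a q\<close> otherwise.\<close>

lemma initial_nonzerodivisor_horner:
  assumes B: "is_ideal B" "I \<union> insert a F \<subseteq> B"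
    and C: "adic_nonzerodivisor I F a"
    and p: "p = 0 \<or> (\<exists>d. initial_nonzerodivisor I F B d p)"
    and q: "q = 0 \<or> (\<exists>d. initial_nonzerodivisor I (insert a F) B d q)"
    and ne: "(\<exists>d. initial_nonzerodivisor I F B d p) \<or>
      (\<exists>d. initial_nonzerodivisor I (insert a F) B d q)"
  shows "\<exists>d. initial_nonzerodivisor I (insert a F) B d (p + a * q)"
proof -
  let ?F = "insert a F"
  have mono: "adic I F s UNIV \<subseteq> adic I ?F s UNIV" for s by (rule adic_mono) auto
  have anti: "adic I ?F s UNIV \<subseteq> adic I ?F t UNIV" if "t \<le> s" for s t
    using that by (induction rule: dec_induct) (use adic_Suc_subset in blast)+
  note ins = initial_nonzerodivisor_insert[OF B C]
  note tms = initial_nonzerodivisor_times_last[OF B C]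
  consider e where "p = 0" "initial_nonzerodivisor I ?F B e q"
    | d where "initial_nonzerodivisor I F B d p" "q = 0"
    | d e where "initial_nonzerodivisor I F B d p" "initial_nonzerodivisor I ?F B e q"
    using p q ne by blast
  then show ?thesis
  proof cases
    case (1 e)
    then show ?thesis using tms by auto
  next
    case (2 d)
    note d = 2(1)
    then have "p + a * 0 \<in> adic I ?F d UNIV"
      using mono unfolding initial_nonzerodivisor_def by auto
    from ins[OF d this] 2 show ?thesis by auto
  next
    case (3 d e)
    note d = 3(1) and e = 3(2)
    have pd: "p \<in> adic I ?F d UNIV" and aq: "a * q \<in> adic I ?F (Suc e) UNIV"
      using d tms[OF e] mono unfolding initial_nonzerodivisor_def by blast+
    show ?thesis
    proof (cases "d \<le> Suc e")
      case True
      have "p + a * q \<in> adic I ?F d UNIV"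
        using pd aq anti[OF True] ideal.subspace_add[OF is_ideal_adic] by blast
      then show ?thesis using ins[OF d] by blast
    next
      case False
      then have "p \<in> adic I ?F (Suc (Suc e)) UNIV" using pd anti[of "Suc (Suc e)" d] by auto
      then show ?thesis using initial_nonzerodivisor_perturb[OF B tms[OF e]] by blast
    qed
  qed
qed

lemma initial_nonzerodivisor_sum_powers:
  assumes B: "is_ideal B" "I \<union> insert a F \<subseteq> B"
    and C: "adic_nonzerodivisor I F a"
    and p: "\<And>j. j < D \<Longrightarrow> p j = 0 \<or> (\<exists>d. initial_nonzerodivisor I F B d (p j))"
    and ne: "\<exists>j<D. \<exists>d. initial_nonzerodivisor I F B d (p j)"
  shows "\<exists>d. initial_nonzerodivisor I (insert a F) B d (\<Sum>j<D. a ^ j * p j)"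
  using p ne
proof (induction D arbitrary: p)
  case (Suc D)
  let ?q = "\<Sum>j<D. a ^ j * p (Suc j)"
  have eq: "(\<Sum>j<Suc D. a ^ j * p j) = p 0 + a * ?q"
    by (simp add: sum.lessThan_Suc_shift sum_distrib_left mult.assoc del: sum.lessThan_Suc)
  have q: "\<exists>d. initial_nonzerodivisor I (insert a F) B d ?q"
    if "\<exists>j<D. \<exists>d. initial_nonzerodivisor I F B d (p (Suc j))"
    by (rule Suc.IH) (use Suc.prems that in auto)
  have q0: "?q = 0" if "\<not> (\<exists>j<D. \<exists>d. initial_nonzerodivisor I F B d (p (Suc j)))"
  proof -
    have "p (Suc j) = 0" if "j < D" for j
      using Suc.prems(1)[of "Suc j"] \<open>\<not> _\<close> that by auto
    then show ?thesis by simp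
  qed
  show ?case unfolding eq
  proof (rule initial_nonzerodivisor_horner[OF B C])
    show "p 0 = 0 \<or> (\<exists>d. initial_nonzerodivisor I F B d (p 0))" using Suc.prems(1) by blast
    show "?q = 0 \<or> (\<exists>d. initial_nonzerodivisor I (insert a F) B d ?q)" using q q0 by blast
    show "(\<exists>d. initial_nonzerodivisor I F B d (p 0)) \<or>
        (\<exists>d. initial_nonzerodivisor I (insert a F) B d ?q)"
      using Suc.prems(2) q by (metis less_Suc_eq_0_disj)
  qed
qed simp

text \<open>An element \<open>a\<close> of the sequence is a nonzerodivisor modulo the ideal \<open>B\<close> of the earlier ones. As a
  form of degree \<open>0\<close>, it therefore acts injectively on the forms in the earlier elements modulo \<open>B\<close>,
  which is shown by adjoining these elements one by one. So multiplication by \<open>a\<close> does not raise the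
  order of an element.\<close>

lemma regular_adic_nonzerodivisor:
  assumes reg: "\<And>i g. i < length fs \<Longrightarrow> fs ! i * g \<in> ideal_of (I \<union> set (take i fs)) \<Longrightarrow>
      g \<in> ideal_of (I \<union> set (take i fs))"
    and "n < length fs"
  shows "adic_nonzerodivisor I (set (take n fs)) (fs ! n)"
  using \<open>n < length fs\<close>
proof (induction n rule: less_induct)
  case (less n)
  define B where "B = ideal_of (I \<union> set (take n fs))"
  have B: "is_ideal B" "I \<union> set (take n fs) \<subseteq> B" unfolding B_def by (auto intro: ideal.span_base)
  have "initial_nonzerodivisor I (set (take k fs)) B 0 (fs ! n)" if "k \<le> n" for k
    using that
  proof (induction k)
    case 0
    show ?case
      using initial_nonzerodivisor_empty[OF B(1), of I "fs ! n"] B(2) reg[OF less.prems]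
      unfolding B_def by simp
  next
    case (Suc k)
    have ins: "set (take (Suc k) fs) = insert (fs ! k) (set (take k fs))"
      using Suc.prems less.prems by (simp add: take_Suc_conv_app_nth)
    have "set (take (Suc k) fs) \<subseteq> set (take n fs)" using Suc.prems by (rule set_take_subset_set_take)
    then have sub: "I \<union> insert (fs ! k) (set (take k fs)) \<subseteq> B" using B(2) unfolding ins by blast
    have "adic_nonzerodivisor I (set (take k fs)) (fs ! k)"
      using Suc.prems less by simp
    from initial_nonzerodivisor_insert[OF B(1) sub this, of 0 "fs ! n" 0] Suc
    show ?case unfolding ins by simp
  qed
  then have init: "initial_nonzerodivisor I (set (take n fs)) B 0 (fs ! n)" by blast
  show ?case unfolding adic_nonzerodivisor_def
  proof (intro allI impI)
    fix j g assume "fs ! n * g \<in> adic I (set (take n fs)) j UNIV"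
    then show "g \<in> adic I (set (take n fs)) j UNIV"
    proof (induction j)
      case (Suc j)
      then have "g \<in> adic I (set (take n fs)) j UNIV" using adic_Suc_subset by blast
      moreover have "fs ! n * g \<in> adic I (set (take n fs)) (j + 0) B"
        using Suc.prems unfolding adic_Suc_UNIV B_def by simp
      ultimately have "g \<in> adic I (set (take n fs)) j B"
        using init unfolding initial_nonzerodivisor_def by blast
      then show ?case unfolding adic_Suc_UNIV B_def .
    qed simp
  qed
qed

text \<open>Injectivity on the associated graded module raises the order of \<open>h\<close> step by step.\<close>

lemma initial_nonzerodivisor_annihilates:
  assumes "initial_nonzerodivisor I F (ideal_of (I \<union> F)) d p" and "p * h \<in> ideal_of I"
  shows "h \<in> adic I F s UNIV"
proof (induction s)
  case (Suc s)
  have "ideal_of I \<subseteq> adic I F (s + d) (ideal_of (I \<union> F))"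
    by (rule ideal_of_leI[OF base_subset_adic]) simp
  then have "h \<in> adic I F s (ideal_of (I \<union> F))"
    using assms Suc unfolding initial_nonzerodivisor_def by blast
  then show ?case by (simp add: adic_Suc_UNIV)
qed simp

lemma sum_monomials_Suc:
  fixes f :: "nat \<Rightarrow> 'a::comm_ring_1"
  shows "(\<Sum>\<alpha>\<in>{..<Suc n} \<rightarrow>\<^sub>E {..<D}. c \<alpha> * (\<Prod>i<Suc n. f i ^ \<alpha> i)) =
    (\<Sum>j<D. f n ^ j * (\<Sum>\<alpha>\<in>{..<n} \<rightarrow>\<^sub>E {..<D}. c (\<alpha>(n := j)) * (\<Prod>i<n. f i ^ \<alpha> i)))"
proof -
  let ?E = "{..<n} \<rightarrow>\<^sub>E {..<D}"
  have inj: "inj_on (\<lambda>(j, \<alpha>). \<alpha>(n := j)) ({..<D} \<times> ?E)"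
  proof (rule inj_onI, clarify)
    fix j \<alpha> j' \<alpha>' assume \<alpha>: "\<alpha> \<in> ?E" "\<alpha>' \<in> ?E" and eq: "\<alpha>(n := j) = \<alpha>'(n := j')"
    have "j = j'" using fun_cong[OF eq, of n] by simp
    moreover have "\<alpha> i = \<alpha>' i" for i
      using fun_cong[OF eq, of i] PiE_arb[OF \<alpha>(1), of n] PiE_arb[OF \<alpha>(2), of n] by (cases "i = n") auto
    ultimately show "j = j' \<and> \<alpha> = \<alpha>'" by auto
  qed
  have "{..<Suc n} \<rightarrow>\<^sub>E {..<D} = (\<lambda>(j, \<alpha>). \<alpha>(n := j)) ` ({..<D} \<times> ?E)"
    by (simp add: lessThan_Suc PiE_insert_eq)
  then have "(\<Sum>\<alpha>\<in>{..<Suc n} \<rightarrow>\<^sub>E {..<D}. c \<alpha> * (\<Prod>i<Suc n. f i ^ \<alpha> i)) =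
      (\<Sum>(j, \<alpha>)\<in>{..<D} \<times> ?E. c (\<alpha>(n := j)) * (\<Prod>i<Suc n. f i ^ (\<alpha>(n := j)) i))"
    by (simp only: sum.reindex[OF inj[unfolded case_prod_unfold]] comp_def case_prod_unfold)
  also have "\<dots> = (\<Sum>(j, \<alpha>)\<in>{..<D} \<times> ?E. f n ^ j * (c (\<alpha>(n := j)) * (\<Prod>i<n. f i ^ \<alpha> i)))"
    by (intro sum.cong refl) (auto simp: ac_simps intro!: prod.cong)
  also have "\<dots> = (\<Sum>j<D. \<Sum>\<alpha>\<in>?E. f n ^ j * (c (\<alpha>(n := j)) * (\<Prod>i<n. f i ^ \<alpha> i)))"
    by (rule sum.cartesian_product[symmetric])
  finally show ?thesis by (simp only: sum_distrib_left)
qed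

text \<open>Quasi-regularity, for the values of nonzero polynomials whose coefficients are zero or units. The
  polynomial is expanded by powers of its last variable.\<close>

lemma initial_nonzerodivisor_polynomial:
  fixes f :: "nat \<Rightarrow> 'a::comm_ring_1"
  assumes reg: "\<And>i. i < n \<Longrightarrow> adic_nonzerodivisor I (f ` {..<i}) (f i)"
    and B: "is_ideal B" "I \<union> f ` {..<n} \<subseteq> B"
    and c: "\<And>\<alpha>. c \<alpha> = 0 \<or> c \<alpha> dvd 1"
    and ne: "\<exists>\<alpha> \<in> {..<n} \<rightarrow>\<^sub>E {..<D}. c \<alpha> \<noteq> 0"
  shows "\<exists>d. initial_nonzerodivisor I (f ` {..<n}) B d
    (\<Sum>\<alpha>\<in>{..<n} \<rightarrow>\<^sub>E {..<D}. c \<alpha> * (\<Prod>i<n. f i ^ \<alpha> i))"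
  using reg B(2) c ne
proof (induction n arbitrary: c)
  case 0
  let ?u = "c (\<lambda>_. undefined)"
  have "?u dvd 1" using 0 by (auto simp: PiE_empty_domain)
  then obtain v where v: "?u * v = 1" by (metis dvdE)
  have "g \<in> B" if "?u * g \<in> B" for g
  proof -
    have "v * (?u * g) \<in> B" using that B(1) by (rule ideal.subspace_scale[rotated])
    moreover have "v * (?u * g) = g"
      using v by (metis mult.assoc mult.commute mult_1)
    ultimately show ?thesis by simp
  qed
  then show ?case using initial_nonzerodivisor_empty[OF B(1)] 0 by (auto simp: PiE_empty_domain)
next
  case (Suc n)
  have ins: "f ` {..<Suc n} = insert (f n) (f ` {..<n})" by (simp add: lessThan_Suc)
  let ?p = "\<lambda>j. \<Sum>\<alpha>\<in>{..<n} \<rightarrow>\<^sub>E {..<D}. c (\<alpha>(n := j)) * (\<Prod>i<n. f i ^ \<alpha> i)"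
  have IH: "\<exists>d. initial_nonzerodivisor I (f ` {..<n}) B d (?p j)"
    if "\<exists>\<alpha> \<in> {..<n} \<rightarrow>\<^sub>E {..<D}. c (\<alpha>(n := j)) \<noteq> 0" for j
    by (rule Suc.IH) (use Suc.prems(1-3) that in \<open>auto simp: ins simp del: fun_upd_apply\<close>)
  show ?case unfolding sum_monomials_Suc unfolding ins
  proof (rule initial_nonzerodivisor_sum_powers[OF B(1)])
    show "I \<union> insert (f n) (f ` {..<n}) \<subseteq> B" using Suc.prems(2) unfolding ins .
    show "adic_nonzerodivisor I (f ` {..<n}) (f n)" using Suc.prems(1) by simp
    show "?p j = 0 \<or> (\<exists>d. initial_nonzerodivisor I (f ` {..<n}) B d (?p j))" for j
    proof (cases "\<exists>\<alpha> \<in> {..<n} \<rightarrow>\<^sub>E {..<D}. c (\<alpha>(n := j)) \<noteq> 0")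
      case False
      then have "?p j = 0" by (intro sum.neutral) auto
      then show ?thesis by simp
    qed (use IH in blast)
    obtain \<beta> where "\<beta> \<in> {..<Suc n} \<rightarrow>\<^sub>E {..<D}" "c \<beta> \<noteq> 0" using Suc.prems(4) by blast
    then obtain j \<alpha> where "j < D" "\<alpha> \<in> {..<n} \<rightarrow>\<^sub>E {..<D}" "c (\<alpha>(n := j)) \<noteq> 0"
      by (auto simp: lessThan_Suc PiE_insert_eq)
    then show "\<exists>j<D. \<exists>d. initial_nonzerodivisor I (f ` {..<n}) B d (?p j)" using IH by blast
  qed
qed

section \<open>Degrees in monomial ideals\<close>

definition total_degree :: "('v::finite \<Rightarrow>\<^sub>0 nat) \<Rightarrow> nat" where
  "total_degree u = (\<Sum>x\<in>UNIV. Poly_Mapping.lookup u x)"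

lemma total_degree_add: "total_degree (u + w) = total_degree u + total_degree w"
  by (simp add: total_degree_def lookup_add sum.distrib)

lemma total_degree_single: "total_degree (Poly_Mapping.single x k) = k"
  by (simp add: total_degree_def lookup_single when_def)

lemma keys_mult_cases:
  assumes "u \<in> Poly_Mapping.keys (f * g)"
  obtains a b where "a \<in> Poly_Mapping.keys f" "b \<in> Poly_Mapping.keys g" "u = a + b"
  using keys_mult assms by blast

lemma is_ideal_monomial:
  fixes T :: "('v \<Rightarrow>\<^sub>0 nat) \<Rightarrow> bool"
  assumes "\<And>u w. T u \<Longrightarrow> T (u + w)"
  shows "is_ideal {g :: ('v, 'k::comm_ring_1) mpoly. \<forall>u\<in>Poly_Mapping.keys g. T u}"
proof (rule ideal.subspaceI)
  fix f g :: "('v, 'k) mpoly"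
  assume "g \<in> {g. \<forall>u\<in>Poly_Mapping.keys g. T u}"
  then show "f * g \<in> {g. \<forall>u\<in>Poly_Mapping.keys g. T u}"
    by (auto elim!: keys_mult_cases) (metis assms add.commute)
next
  fix f g :: "('v, 'k) mpoly"
  assume "f \<in> {g. \<forall>u\<in>Poly_Mapping.keys g. T u}" "g \<in> {g. \<forall>u\<in>Poly_Mapping.keys g. T u}"
  then show "f + g \<in> {g. \<forall>u\<in>Poly_Mapping.keys g. T u}"
    using keys_add[of f g] by blast
qed simp

text \<open>A substitute for Krull's intersection theorem: a term of an element of \<open>I + (F)\<^sup>s\<close> lies in the
  monomial ideal \<open>I\<close> or has degree at least \<open>s\<close>.\<close>

lemma adic_monomial_order:
  fixes F :: "('v::finite, 'k::comm_ring_1) mpoly set"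
  assumes T: "\<And>u w. T u \<Longrightarrow> T (u + w)"
    and F: "F \<subseteq> ideal_of (range indet)"
  shows "adic {g. \<forall>u\<in>Poly_Mapping.keys g. T u} F s UNIV \<subseteq>
    {g. \<forall>u\<in>Poly_Mapping.keys g. T u \<or> s \<le> total_degree u}"
proof (induction s)
  case (Suc s)
  have F1: "F \<subseteq> {g. \<forall>u\<in>Poly_Mapping.keys g. 1 \<le> total_degree u}"
  proof (rule order_trans[OF F], rule ideal_of_leI)
    show "range indet \<subseteq> {g :: ('v, 'k) mpoly. \<forall>u\<in>Poly_Mapping.keys g. 1 \<le> total_degree u}"
      by (auto simp: indet_def total_degree_single)
    show "is_ideal {g :: ('v, 'k) mpoly. \<forall>u\<in>Poly_Mapping.keys g. 1 \<le> total_degree u}"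
      by (rule is_ideal_monomial) (simp add: total_degree_add)
  qed
  show ?case unfolding adic.simps(2)
  proof (rule ideal_of_leI)
    show "is_ideal {g :: ('v, 'k) mpoly. \<forall>u\<in>Poly_Mapping.keys g. T u \<or> Suc s \<le> total_degree u}"
      by (rule is_ideal_monomial) (use T in \<open>auto simp: total_degree_add\<close>)
    have "T u \<or> Suc s \<le> total_degree u"
      if f: "f \<in> F" and g: "g \<in> adic {g. \<forall>u\<in>Poly_Mapping.keys g. T u} F s UNIV"
        and u: "u \<in> Poly_Mapping.keys (f * g)" for f g u
      using u
    proof (rule keys_mult_cases)
      fix a b assume ab: "a \<in> Poly_Mapping.keys f" "b \<in> Poly_Mapping.keys g" "u = a + b"
      have "1 \<le> total_degree a" using F1 f ab(1) by blast
      moreover have "T b \<or> s \<le> total_degree b" using Suc g ab(2) by blast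
      ultimately show ?thesis using T[of b a] by (auto simp: ab(3) total_degree_add add.commute)
    qed
    then show "{g. \<forall>u\<in>Poly_Mapping.keys g. T u} \<union>
        {f * g |f g. f \<in> F \<and> g \<in> adic {g. \<forall>u\<in>Poly_Mapping.keys g. T u} F s UNIV}
      \<subseteq> {g. \<forall>u\<in>Poly_Mapping.keys g. T u \<or> Suc s \<le> total_degree u}"
      by blast
  qed
qed simp

section \<open>Algebraic dependence by counting monomials\<close>

lemma nontrivial_linear_relation:
  fixes v :: "'b \<Rightarrow> 'x \<Rightarrow> 'k::field"
  assumes "finite X" "finite A" "card X < card A"
  shows "\<exists>c. (\<exists>b\<in>A. c b \<noteq> 0) \<and> (\<forall>x\<in>X. (\<Sum>b\<in>A. c b * v b x) = 0)"
  using assms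
proof (induction X arbitrary: A v rule: finite_induct)
  case empty
  then have "A \<noteq> {}" by auto
  then show ?case by (intro exI[of _ "\<lambda>_. 1"]) auto
next
  case (insert x X)
  show ?case
  proof (cases "\<forall>b\<in>A. v b x = 0")
    case True
    from insert.IH[of A v] insert.prems insert.hyps obtain c where
      "\<exists>b\<in>A. c b \<noteq> 0" "\<forall>x\<in>X. (\<Sum>b\<in>A. c b * v b x) = 0" by auto
    then show ?thesis using True by (intro exI[of _ c]) auto
  next
    case False
    then obtain b0 where b0: "b0 \<in> A" "v b0 x \<noteq> 0" by blast
    define w where "w b y = v b y - v b x / v b0 x * v b0 y" for b y
    have "card X < card (A - {b0})" using insert.prems insert.hyps b0 by auto
    then obtain c where c: "\<exists>b\<in>A - {b0}. c b \<noteq> 0"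
      and rel: "\<forall>y\<in>X. (\<Sum>b\<in>A - {b0}. c b * w b y) = 0"
      using insert.IH[of "A - {b0}" w] insert.prems by auto
    \<comment> \<open>The coordinate \<open>x\<close> is eliminated with the pivot \<open>v b0 x\<close>.\<close>
    define c' where "c' = c(b0 := - (\<Sum>b\<in>A - {b0}. c b * (v b x / v b0 x)))"
    have sum: "(\<Sum>b\<in>A. c' b * v b y) = (\<Sum>b\<in>A - {b0}. c b * w b y)" for y
    proof -
      have "(\<Sum>b\<in>A. c' b * v b y) = c' b0 * v b0 y + (\<Sum>b\<in>A - {b0}. c' b * v b y)"
        by (rule sum.remove[OF insert.prems(1) b0(1)])
      also have "\<dots> = (\<Sum>b\<in>A - {b0}. c b * v b y) - (\<Sum>b\<in>A - {b0}. c b * (v b x / v b0 x) * v b0 y)"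
        by (auto simp: c'_def sum_distrib_right intro!: sum.cong)
      also have "\<dots> = (\<Sum>b\<in>A - {b0}. c b * w b y)"
        unfolding sum_subtractf[symmetric] by (intro sum.cong) (auto simp: w_def algebra_simps)
      finally show ?thesis .
    qed
    have "w b x = 0" for b using b0 by (simp add: w_def)
    then have "\<forall>y\<in>insert x X. (\<Sum>b\<in>A. c' b * v b y) = 0" using rel unfolding sum by auto
    moreover have "\<exists>b\<in>A. c' b \<noteq> 0" using c by (auto simp: c'_def)
    ultimately show ?thesis by blast
  qed
qed

definition exponents_le :: "nat \<Rightarrow> ('v, 'k::comm_ring_1) mpoly \<Rightarrow> bool" where
  "exponents_le N p \<longleftrightarrow> (\<forall>u\<in>Poly_Mapping.keys p. \<forall>x. Poly_Mapping.lookup u x \<le> N)"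

lemma exponents_le_mult:
  assumes "exponents_le M p" "exponents_le N q"
  shows "exponents_le (M + N) (p * q)"
  unfolding exponents_le_def
proof (intro ballI allI)
  fix u x assume "u \<in> Poly_Mapping.keys (p * q)"
  then obtain a b where "a \<in> Poly_Mapping.keys p" "b \<in> Poly_Mapping.keys q" "u = a + b"
    by (rule keys_mult_cases)
  then show "Poly_Mapping.lookup u x \<le> M + N"
    using assms unfolding exponents_le_def by (simp add: lookup_add add_mono)
qed

lemma exponents_le_one: "exponents_le N 1"
  unfolding exponents_le_def by (simp add: keys_one)

lemma exponents_le_power: "exponents_le N p \<Longrightarrow> exponents_le (k * N) (p ^ k)"
  by (induction k) (auto simp: exponents_le_one intro: exponents_le_mult)

lemma exponents_le_prod:
  assumes "\<And>i. i \<in> A \<Longrightarrow> exponents_le (N i) (p i)"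
  shows "exponents_le (\<Sum>i\<in>A. N i) (\<Prod>i\<in>A. p i)"
  using assms
  by (induction A rule: infinite_finite_induct) (auto simp: exponents_le_one intro: exponents_le_mult)

lemma exponents_le_mono: "exponents_le M p \<Longrightarrow> M \<le> N \<Longrightarrow> exponents_le N p"
  unfolding exponents_le_def by (meson order_trans)

lemma finite_exponents_le:
  fixes f :: "nat \<Rightarrow> ('v, 'k::comm_ring_1) mpoly"
  shows "\<exists>e. \<forall>i<n. exponents_le e (f i)"
proof -
  have "\<exists>e. exponents_le e p" for p :: "('v, 'k) mpoly"
  proof -
    let ?L = "\<Union>u\<in>Poly_Mapping.keys p. range (Poly_Mapping.lookup u)"
    have "range (Poly_Mapping.lookup u) \<subseteq> insert 0 (Poly_Mapping.lookup u ` Poly_Mapping.keys u)"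
      for u :: "'v \<Rightarrow>\<^sub>0 nat"
      by (auto simp: in_keys_iff)
    then have "finite (range (Poly_Mapping.lookup u))" for u :: "'v \<Rightarrow>\<^sub>0 nat"
      by (rule finite_subset) simp
    then have "finite ?L" by simp
    then obtain e where "\<forall>k\<in>?L. k \<le> e" unfolding finite_nat_set_iff_bounded_le by blast
    then show ?thesis unfolding exponents_le_def by blast
  qed
  then have "\<forall>i. \<exists>e. exponents_le e (f i)" by blast
  then obtain e where e: "exponents_le (e i) (f i)" for i by metis
  have "exponents_le (\<Sum>i<n. e i) (f i)" if "i < n" for i
    by (rule exponents_le_mono[OF e]) (use that in \<open>auto intro: member_le_sum\<close>)
  then show ?thesis by blast
qed

lemma card_bounded_monomials:
  fixes S :: "'v set" and N :: nat
  assumes "finite S"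
  defines "X \<equiv> {u :: 'v \<Rightarrow>\<^sub>0 nat. Poly_Mapping.keys u \<subseteq> S \<and> (\<forall>x. Poly_Mapping.lookup u x \<le> N)}"
  shows "finite X" and "card X \<le> (N + 1) ^ card S"
proof -
  let ?r = "\<lambda>u :: 'v \<Rightarrow>\<^sub>0 nat. restrict (Poly_Mapping.lookup u) S"
  have inj: "inj_on ?r X"
  proof (rule inj_onI)
    fix u w assume uw: "u \<in> X" "w \<in> X" and eq: "?r u = ?r w"
    show "u = w"
    proof (rule poly_mapping_eqI)
      fix x
      show "Poly_Mapping.lookup u x = Poly_Mapping.lookup w x"
        using fun_cong[OF eq, of x] uw unfolding X_def
        by (cases "x \<in> S") (auto simp: in_keys_iff subset_iff, metis neq0_conv)
    qed
  qed
  have sub: "?r ` X \<subseteq> S \<rightarrow>\<^sub>E {..N}" unfolding X_def by auto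
  have fin: "finite (S \<rightarrow>\<^sub>E {..N})" using assms(1) by (intro finite_PiE) auto
  show "finite X" using inj_on_finite[OF inj sub fin] .
  show "card X \<le> (N + 1) ^ card S"
    using card_inj_on_le[OF inj sub fin] assms(1) by (simp add: card_PiE)
qed

lemma lookup_const_mult:
  "Poly_Mapping.lookup (Poly_Mapping.single 0 c * p) u = c * Poly_Mapping.lookup p u"
  for p :: "('v, 'k::comm_ring_1) mpoly"
  by (simp add: mult_map_scale_conv_mult[symmetric] map.rep_eq when_def)

text \<open>The \<open>D\<^sup>n\<close> products of powers \<open>f\<^sub>i\<^bsup>\<alpha>\<^sub>i\<^esup>\<close> with \<open>\<alpha>\<^sub>i < D\<close> have exponents of size \<open>O(D)\<close>, so their
  images in the polynomial ring with variables in \<open>S\<close> lie in a space of dimension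
  \<open>O(D\<^bsup>card S\<^esup>)\<close>. For \<open>n > card S\<close> and \<open>D\<close> large, some linear combination vanishes there.\<close>

lemma algebraically_dependent_modulo:
  fixes f :: "nat \<Rightarrow> ('v, 'k::field) mpoly" and S :: "'v set"
  assumes S: "finite S" "card S < n"
  shows "\<exists>D c. (\<exists>\<alpha> \<in> {..<n} \<rightarrow>\<^sub>E {..<D}. c \<alpha> \<noteq> 0) \<and>
    (\<forall>u\<in>Poly_Mapping.keys (\<Sum>\<alpha>\<in>{..<n} \<rightarrow>\<^sub>E {..<D}.
        Poly_Mapping.single 0 (c \<alpha>) * (\<Prod>i<n. f i ^ \<alpha> i)). \<not> Poly_Mapping.keys u \<subseteq> S)"
proof -
  obtain e where e: "\<forall>i<n. exponents_le e (f i)" using finite_exponents_le by blast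
  \<comment> \<open>This \<open>D\<close> satisfies \<open>(n D e + 1)\<^bsup>card S\<^esup> \<le> D\<^bsup>card S\<^esup> (n e + 1)\<^bsup>card S\<^esup> < D\<^bsup>card S + 1\<^esup>\<close>.\<close>
  define D where "D = (n * e + 1) ^ card S + 1"
  define N where "N = n * (D * e)"
  let ?E = "{..<n} \<rightarrow>\<^sub>E {..<D}"
  let ?X = "{u :: 'v \<Rightarrow>\<^sub>0 nat. Poly_Mapping.keys u \<subseteq> S \<and> (\<forall>x. Poly_Mapping.lookup u x \<le> N)}"
  let ?m = "\<lambda>\<alpha>. \<Prod>i<n. f i ^ \<alpha> i"
  have "N + 1 \<le> D * (n * e + 1)" by (simp add: N_def D_def algebra_simps)
  then have "(N + 1) ^ card S \<le> (D * (n * e + 1)) ^ card S" by (rule power_mono) simp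
  also have "\<dots> = D ^ card S * (n * e + 1) ^ card S" by (rule power_mult_distrib)
  also have "\<dots> < D ^ card S * D" by (intro mult_strict_left_mono) (auto simp: D_def)
  also have "\<dots> = D ^ Suc (card S)" by simp
  also have "\<dots> \<le> D ^ n" using S(2) by (intro power_increasing) (auto simp: D_def)
  also have "\<dots> = card ?E" by (simp add: card_PiE)
  finally have "card ?X < card ?E"
    using card_bounded_monomials(2)[OF S(1), of N] by linarith
  then obtain c where ne: "\<exists>\<alpha>\<in>?E. c \<alpha> \<noteq> 0"
    and rel: "\<forall>u\<in>?X. (\<Sum>\<alpha>\<in>?E. c \<alpha> * Poly_Mapping.lookup (?m \<alpha>) u) = 0"
    using nontrivial_linear_relation[OF card_bounded_monomials(1)[OF S(1)], of ?E N
        "\<lambda>\<alpha> u. Poly_Mapping.lookup (?m \<alpha>) u"] by (auto intro: finite_PiE)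
  let ?p = "\<Sum>\<alpha>\<in>?E. Poly_Mapping.single 0 (c \<alpha>) * ?m \<alpha>"
  have lookup: "Poly_Mapping.lookup ?p u = (\<Sum>\<alpha>\<in>?E. c \<alpha> * Poly_Mapping.lookup (?m \<alpha>) u)" for u
    by (simp add: lookup_sum lookup_const_mult)
  have N: "exponents_le N (?m \<alpha>)" if "\<alpha> \<in> ?E" for \<alpha>
  proof -
    have "exponents_le (\<Sum>i<n. \<alpha> i * e) (?m \<alpha>)"
      using e by (intro exponents_le_prod exponents_le_power) auto
    moreover have "(\<Sum>i<n. \<alpha> i * e) \<le> (\<Sum>i<n. D * e)"
      by (intro sum_mono mult_right_mono) (use that in \<open>auto intro: less_imp_le\<close>)
    ultimately show ?thesis by (auto simp: N_def intro: exponents_le_mono)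
  qed
  have "\<not> Poly_Mapping.keys u \<subseteq> S" if u: "u \<in> Poly_Mapping.keys ?p" for u
  proof
    assume "Poly_Mapping.keys u \<subseteq> S"
    have "(\<Sum>\<alpha>\<in>?E. c \<alpha> * Poly_Mapping.lookup (?m \<alpha>) u) = 0"
    proof (cases "\<forall>x. Poly_Mapping.lookup u x \<le> N")
      case True
      then show ?thesis using rel \<open>Poly_Mapping.keys u \<subseteq> S\<close> by blast
    next
      case False
      then have "u \<notin> Poly_Mapping.keys (?m \<alpha>)" if "\<alpha> \<in> ?E" for \<alpha>
        using N[OF that] unfolding exponents_le_def by blast
      then show ?thesis by (intro sum.neutral) (simp add: in_keys_iff)
    qed
    then show False using u lookup by (simp add: in_keys_iff)
  qed
  then show ?thesis using ne by blast
qed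

section \<open>Depth of quotients by monomial ideals\<close>

text \<open>The monomial \<open>w\<close> is annihilated modulo the ideal by all variables outside \<open>S\<close>, hence by a suitable
  polynomial expression in too long a sequence, which is impossible for a regular one.\<close>

lemma depth_quotient_monomial_le:
  fixes T :: "('v::finite \<Rightarrow>\<^sub>0 nat) \<Rightarrow> bool"
  assumes T: "\<And>u w. T u \<Longrightarrow> T (u + w)"
    and w: "\<not> T w" and max: "\<And>x. x \<notin> S \<Longrightarrow> T (w + Poly_Mapping.single x 1)"
  shows "depth_quotient {g :: ('v, 'k::field) mpoly. \<forall>u\<in>Poly_Mapping.keys g. T u} \<le> enat (card S)"
proof -
  define I where "I = {g :: ('v, 'k) mpoly. \<forall>u\<in>Poly_Mapping.keys g. T u}"
  define h :: "('v, 'k) mpoly" where "h = Poly_Mapping.single w 1"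
  have I: "is_ideal I" unfolding I_def by (rule is_ideal_monomial) (rule T)
  have "h \<notin> I" using w by (simp add: I_def h_def)
  have "length fs \<le> card S"
    if fs: "set fs \<subseteq> ideal_of (range indet)" "regular_on_quotient I fs" for fs
  proof (rule ccontr)
    define n where "n = length fs"
    assume "\<not> length fs \<le> card S"
    then have n: "card S < n" by (simp add: n_def)
    define F where "F = (!) fs ` {..<n}"
    have take: "set (take i fs) = (!) fs ` {..<i}" if "i \<le> length fs" for i
      using that by (simp add: nth_image[symmetric] lessThan_atLeast0)
    have F: "F = set fs" using take[of n] by (simp add: F_def n_def)
    let ?m = "\<lambda>\<alpha>. \<Prod>i<n. (fs ! i) ^ \<alpha> i"
    obtain D c where c: "\<exists>\<alpha> \<in> {..<n} \<rightarrow>\<^sub>E {..<D}. c \<alpha> \<noteq> 0"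
      and dep: "\<forall>u\<in>Poly_Mapping.keys (\<Sum>\<alpha>\<in>{..<n} \<rightarrow>\<^sub>E {..<D}.
        Poly_Mapping.single 0 (c \<alpha>) * ?m \<alpha>). \<not> Poly_Mapping.keys u \<subseteq> S"
      using algebraically_dependent_modulo[OF finite[of S] n, of "(!) fs"] by blast
    define p where "p = (\<Sum>\<alpha>\<in>{..<n} \<rightarrow>\<^sub>E {..<D}. Poly_Mapping.single 0 (c \<alpha>) * ?m \<alpha>)"
    have unit: "Poly_Mapping.single 0 (c \<alpha>) = (0 :: ('v, 'k) mpoly) \<or>
        (Poly_Mapping.single 0 (c \<alpha>) :: ('v, 'k) mpoly) dvd 1" for \<alpha>
    proof (cases "c \<alpha> = 0")
      case False
      then have "(1 :: ('v, 'k) mpoly) = Poly_Mapping.single 0 (c \<alpha>) * Poly_Mapping.single 0 (1 / c \<alpha>)"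
        by (simp add: mult_single)
      then show ?thesis by (metis dvdI)
    qed simp
    have reg: "adic_nonzerodivisor I ((!) fs ` {..<i}) (fs ! i)" if "i < n" for i
      using regular_adic_nonzerodivisor[of fs I i] fs(2) that take[of i]
      unfolding regular_on_quotient_def n_def by auto
    have ne: "\<exists>\<alpha> \<in> {..<n} \<rightarrow>\<^sub>E {..<D}. Poly_Mapping.single 0 (c \<alpha>) \<noteq> (0 :: ('v, 'k) mpoly)"
      using c by (metis lookup_single_eq lookup_zero)
    have "\<exists>d. initial_nonzerodivisor I F (ideal_of (I \<union> F)) d p"
      unfolding F_def p_def
      by (rule initial_nonzerodivisor_polynomial[OF reg])
        (use ne unit in \<open>auto intro: ideal.span_base\<close>)
    then obtain d where d: "initial_nonzerodivisor I F (ideal_of (I \<union> F)) d p" by blast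
    \<comment> \<open>Every term of \<open>p\<close> has a variable outside \<open>S\<close>, which multiplies \<open>w\<close> into the ideal.\<close>
    have "T v" if "v \<in> Poly_Mapping.keys (p * h)" for v
      using that
    proof (rule keys_mult_cases)
      fix a b assume a: "a \<in> Poly_Mapping.keys p" and b: "b \<in> Poly_Mapping.keys h" and v: "v = a + b"
      obtain x where x: "x \<in> Poly_Mapping.keys a" "x \<notin> S" using dep a unfolding p_def by blast
      have "a = Poly_Mapping.single x 1 + (a - Poly_Mapping.single x 1)"
        by (rule poly_mapping_eqI) (use x(1) in \<open>auto simp: lookup_add lookup_minus lookup_single when_def in_keys_iff\<close>)
      then have "v = (w + Poly_Mapping.single x 1) + (a - Poly_Mapping.single x 1)"
        using b v by (simp add: h_def ac_simps)
      then show "T v" using T[OF max[OF x(2)]] by simp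
    qed
    then have "p * h \<in> ideal_of I" by (intro ideal.span_base) (simp add: I_def)
    from initial_nonzerodivisor_annihilates[OF d this, of "Suc (total_degree w)"]
    have "h \<in> {g. \<forall>u\<in>Poly_Mapping.keys g. T u \<or> Suc (total_degree w) \<le> total_degree u}"
      using adic_monomial_order[where T = T and F = F, OF T] fs(1) unfolding F I_def by blast
    then show False using w by (simp add: h_def)
  qed
  then show ?thesis unfolding I_def[symmetric] depth_quotient_def
    using \<open>h \<notin> I\<close> by (auto intro!: SUP_least)
qed

section \<open>Squarefree powers of edge ideals\<close>

definition contains_matching :: "'v set set \<Rightarrow> nat \<Rightarrow> 'v set \<Rightarrow> bool" where
  "contains_matching E q S \<longleftrightarrow>
     (\<exists>M. M \<subseteq> E \<and> finite M \<and> card M = q \<and> pairwise disjnt M \<and> \<Union>M \<subseteq> S)"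

lemma contains_matching_mono: "contains_matching E q S \<Longrightarrow> S \<subseteq> S' \<Longrightarrow> contains_matching E q S'"
  unfolding contains_matching_def by blast

definition squarefree_monomial :: "'v set \<Rightarrow> 'v \<Rightarrow>\<^sub>0 nat" where
  "squarefree_monomial A = (\<Sum>x\<in>A. Poly_Mapping.single x 1)"

lemma prod_indet:
  "finite A \<Longrightarrow>
    (\<Prod>x\<in>A. indet x) = (Poly_Mapping.single (squarefree_monomial A) 1 :: ('v, 'k::comm_ring_1) mpoly)"
  unfolding squarefree_monomial_def
  by (induction A rule: finite_induct) (simp_all add: indet_def mult_single)

lemma lookup_squarefree:
  "finite A \<Longrightarrow> Poly_Mapping.lookup (squarefree_monomial A) y = (if y \<in> A then 1 else 0)"
  by (simp add: squarefree_monomial_def lookup_sum lookup_single when_def)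

lemma keys_squarefree:
  "finite A \<Longrightarrow> Poly_Mapping.keys (squarefree_monomial A) = A"
  by (auto simp: in_keys_iff lookup_squarefree split: if_splits)

lemma poly_mapping_sum_single:
  "p = (\<Sum>u\<in>Poly_Mapping.keys p. Poly_Mapping.single u (Poly_Mapping.lookup p u))"
  by (rule poly_mapping_eqI) (simp add: lookup_sum lookup_single when_def in_keys_iff)

lemma keys_plus_nat: "Poly_Mapping.keys (u + w :: 'v \<Rightarrow>\<^sub>0 nat) = Poly_Mapping.keys u \<union> Poly_Mapping.keys w"
  by (auto simp: in_keys_iff lookup_add)

lemma squarefree_power_eq:
  "(squarefree_power E q :: ('v::finite, 'k::comm_ring_1) mpoly set) =
    {g. \<forall>u\<in>Poly_Mapping.keys g. contains_matching E q (Poly_Mapping.keys u)}"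
  (is "_ = ?R")
proof
  let ?G = "{(\<Prod>x\<in>\<Union>M. indet x) | M. M \<subseteq> E \<and> finite M \<and> card M = q \<and> pairwise disjnt M}
    :: ('v, 'k) mpoly set"
  have "?G \<subseteq> ?R"
  proof
    fix g assume "g \<in> ?G"
    then obtain M where M: "M \<subseteq> E" "finite M" "card M = q" "pairwise disjnt M"
      and g: "g = (\<Prod>x\<in>\<Union>M. indet x)" by blast
    have "Poly_Mapping.keys u = \<Union>M" if "u \<in> Poly_Mapping.keys g" for u
      using that unfolding g by (simp add: prod_indet keys_squarefree split: if_splits)
    then show "g \<in> ?R" using M unfolding contains_matching_def by blast
  qed
  moreover have "is_ideal ?R"
    by (rule is_ideal_monomial) (auto simp: keys_plus_nat intro: contains_matching_mono)
  ultimately show "squarefree_power E q \<subseteq> ?R"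
    unfolding squarefree_power_def by (rule ideal_of_leI)
  show "?R \<subseteq> squarefree_power E q"
  proof
    fix g :: "('v, 'k) mpoly" assume g: "g \<in> ?R"
    have "Poly_Mapping.single u (Poly_Mapping.lookup g u) \<in> ideal_of ?G"
      if u: "u \<in> Poly_Mapping.keys g" for u
    proof -
      obtain M where M: "M \<subseteq> E" "finite M" "card M = q" "pairwise disjnt M"
        and sub: "\<Union>M \<subseteq> Poly_Mapping.keys u" using g u unfolding contains_matching_def by blast
      let ?s = "squarefree_monomial (\<Union>M)"
      have "u = (u - ?s) + ?s"
        by (rule poly_mapping_eqI)
          (use sub in \<open>auto simp: lookup_add lookup_minus lookup_squarefree in_keys_iff subset_iff\<close>)
      then have "Poly_Mapping.single u (Poly_Mapping.lookup g u) =
          Poly_Mapping.single (u - ?s) (Poly_Mapping.lookup g u) * (\<Prod>x\<in>\<Union>M. indet x)"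
        by (simp add: prod_indet mult_single)
      moreover have "(\<Prod>x\<in>\<Union>M. indet x) \<in> ideal_of ?G" using M by (intro ideal.span_base) blast
      ultimately show ?thesis by (simp add: ideal.span_scale)
    qed
    then have "(\<Sum>u\<in>Poly_Mapping.keys g. Poly_Mapping.single u (Poly_Mapping.lookup g u)) \<in> ideal_of ?G"
      by (rule ideal.span_sum)
    then show "g \<in> squarefree_power E q"
      unfolding squarefree_power_def using poly_mapping_sum_single[of g] by simp
  qed
qed

text \<open>In other words, \<open>S\<close> is a facet of the simplicial complex whose Stanley-Reisner ideal is the
  squarefree power.\<close>

lemma depth_squarefree_power_le:
  fixes E :: "'v::finite set set"
  assumes S: "\<not> contains_matching E q S" and max: "\<And>x. x \<notin> S \<Longrightarrow> contains_matching E q (insert x S)"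
  shows "depth_quotient (squarefree_power E q :: ('v, 'k::field) mpoly set) \<le> enat (card S)"
  unfolding squarefree_power_eq
proof (rule depth_quotient_monomial_le)
  let ?w = "squarefree_monomial S"
  show "contains_matching E q (Poly_Mapping.keys u) \<Longrightarrow> contains_matching E q (Poly_Mapping.keys (u + w))"
    for u w :: "'v \<Rightarrow>\<^sub>0 nat"
    by (auto simp: keys_plus_nat intro: contains_matching_mono)
  show "\<not> contains_matching E q (Poly_Mapping.keys ?w)" using S by (simp add: keys_squarefree)
  show "contains_matching E q (Poly_Mapping.keys (?w + Poly_Mapping.single x 1))" if "x \<notin> S" for x
    using max[OF that] by (simp add: keys_plus_nat keys_squarefree)
qed

section \<open>Whiskered odd cycles\<close>

lemma card_closed_walk_edges:
  assumes "distinct xs" "3 \<le> length xs"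
  shows "card (closed_walk_edges xs) = length xs"
proof -
  let ?L = "length xs"
  let ?e = "\<lambda>i. {xs ! i, xs ! (Suc i mod ?L)}"
  have "inj_on ?e {..<?L}"
  proof (rule inj_onI)
    fix i j assume ij: "i \<in> {..<?L}" "j \<in> {..<?L}" and eq: "?e i = ?e j"
    have lt: "Suc i mod ?L < ?L" "Suc j mod ?L < ?L"
      using assms(2) by (auto intro: mod_less_divisor)
    from eq have "i = j \<or> (i = Suc j mod ?L \<and> Suc i mod ?L = j)"
      using ij lt by (auto simp: doubleton_eq_iff nth_eq_iff_index_eq[OF assms(1)])
    then show "i = j" using ij assms(2) by (auto simp: mod_Suc split: if_splits)
  qed
  moreover have "closed_walk_edges xs = ?e ` {..<?L}"
    unfolding closed_walk_edges_def by auto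
  ultimately show ?thesis by (simp add: card_image)
qed

text \<open>Starting after \<open>x\<close> and going around the cycle, every second edge is taken.\<close>

lemma odd_cycle_matching_avoiding:
  assumes xs: "distinct xs" "length xs = 2 * k + 1" and E: "closed_walk_edges xs \<subseteq> E"
  obtains A where "A \<subseteq> E" "finite A" "card A = k" "pairwise disjnt A" "\<Union>A \<subseteq> set xs - {x}"
proof -
  obtain j where j: "j < length xs" "x \<in> set xs \<Longrightarrow> x = xs ! j"
    using xs(2) by (cases "x \<in> set xs") (auto simp: in_set_conv_nth)
  define ys where "ys = rotate (Suc j) xs"
  have ys: "distinct ys" "length ys = 2 * k + 1" "set ys = set xs" using xs by (auto simp: ys_def)
  have nth: "ys ! i = xs ! ((Suc j + i) mod length xs)" if "i < length xs" for i
    unfolding ys_def by (rule nth_rotate[OF that])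
  have last: "ys ! (2 * k) = xs ! j"
  proof -
    have "Suc j + 2 * k = j + length xs" using xs(2) by simp
    then have "(Suc j + 2 * k) mod length xs = j" using j(1) by (simp only: mod_add_self2 mod_less)
    then show ?thesis using nth[of "2 * k"] xs(2) by simp
  qed
  have edge: "{ys ! i, ys ! Suc i} \<in> E" if "Suc i < length xs" for i
  proof -
    let ?p = "(Suc j + i) mod length xs"
    have "ys ! i = xs ! ?p" "ys ! Suc i = xs ! (Suc ?p mod length xs)"
      using nth[of i] nth[of "Suc i"] that by (simp_all add: mod_Suc_eq)
    moreover have "?p < length xs" using that by (intro mod_less_divisor) linarith
    ultimately show ?thesis using E unfolding closed_walk_edges_def by auto
  qed
  let ?e = "\<lambda>i. {ys ! (2 * i), ys ! Suc (2 * i)}"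
  have idx: "ys ! a = ys ! b \<longleftrightarrow> a = b" if "a \<le> 2 * k" "b \<le> 2 * k" for a b
    using that ys(2) nth_eq_iff_index_eq[OF ys(1), of a b] by simp
  have disj: "?e a \<inter> ?e b = {}" if "a < k" "b < k" "a \<noteq> b" for a b
  proof -
    have "2 * a \<le> 2 * k" "Suc (2 * a) \<le> 2 * k" "2 * b \<le> 2 * k" "Suc (2 * b) \<le> 2 * k"
      "2 * a \<noteq> 2 * b" "2 * a \<noteq> Suc (2 * b)" "Suc (2 * a) \<noteq> 2 * b"
      using that by presburger+
    then show ?thesis by (simp add: idx)
  qed
  show thesis
  proof (rule that[of "?e ` {..<k}"])
    show "?e ` {..<k} \<subseteq> E" using edge xs(2) by auto
    have "inj_on ?e {..<k}"
    proof (rule inj_onI, rule ccontr)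
      fix a b assume "a \<in> {..<k}" "b \<in> {..<k}" "?e a = ?e b" "a \<noteq> b"
      then show False using disj[of a b] by auto
    qed
    then show "card (?e ` {..<k}) = k" by (simp add: card_image)
    show "pairwise disjnt (?e ` {..<k})"
      unfolding pairwise_def disjnt_def using disj by blast
    show "\<Union> (?e ` {..<k}) \<subseteq> set xs - {x}"
    proof
      fix y assume "y \<in> \<Union> (?e ` {..<k})"
      then obtain a where a: "a < k" "y = ys ! (2 * a) \<or> y = ys ! Suc (2 * a)" by auto
      moreover from a(1) have "2 * a < 2 * k" "Suc (2 * a) < 2 * k" by simp_all
      ultimately obtain i where i: "i < 2 * k" "y = ys ! i" by blast
      have "y \<in> set xs" using i ys nth_mem[of i ys] by simp
      moreover have "y \<noteq> xs ! j" using idx[of i "2 * k"] i last by auto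
      ultimately show "y \<in> set xs - {x}" using j(2) by auto
    qed
  qed simp
qed

text \<open>The edges of \<open>M\<close> that meet \<open>T\<close> contain distinct elements of \<open>T\<close>; all others are pairs of vertices
  of \<open>C\<close>, because the whisker ends at vertices of \<open>C\<close> are not available.\<close>

lemma card_matching_le:
  fixes M :: "('v::finite + 'v) set set"
  assumes M: "M \<subseteq> whisker_graph E" "pairwise disjnt M" and E: "simple_graph E"
    and sub: "\<Union>M \<subseteq> Inl ` (C \<union> T) \<union> Inr ` (- C)"
  shows "card M \<le> card T + card C div 2"
proof -
  define M1 where "M1 = {e \<in> M. \<exists>x\<in>T. Inl x \<in> e}"
  define M2 where "M2 = M - M1"
  have same: "e = e'" if "e \<in> M" "e' \<in> M" "z \<in> e" "z \<in> e'" for e e' z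
    using M(2) that unfolding pairwise_def disjnt_def by blast
  have "card M1 \<le> card T"
  proof -
    have "\<forall>e\<in>M1. \<exists>x. x \<in> T \<and> Inl x \<in> e" unfolding M1_def by blast
    then obtain \<phi> where \<phi>: "\<And>e. e \<in> M1 \<Longrightarrow> \<phi> e \<in> T \<and> Inl (\<phi> e) \<in> e" by metis
    have "inj_on \<phi> M1"
    proof (rule inj_onI)
      fix e e' assume e: "e \<in> M1" "e' \<in> M1" and eq: "\<phi> e = \<phi> e'"
      show "e = e'"
      proof (rule same)
        show "e \<in> M" "e' \<in> M" using e unfolding M1_def by auto
        show "Inl (\<phi> e) \<in> e" by (rule conjunct2[OF \<phi>[OF e(1)]])
        show "Inl (\<phi> e) \<in> e'" unfolding eq by (rule conjunct2[OF \<phi>[OF e(2)]])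
      qed
    qed
    moreover have "\<phi> ` M1 \<subseteq> T" using \<phi> by blast
    ultimately show ?thesis by (rule card_inj_on_le) (rule finite)
  qed
  have M2: "e \<subseteq> Inl ` C \<and> card e = 2" if e: "e \<in> M2" for e
  proof -
    have noT: "Inl x \<notin> e" if "x \<in> T" for x using e that unfolding M2_def M1_def by blast
    have eM: "e \<in> M" using e unfolding M2_def by blast
    then have es: "e \<subseteq> Inl ` (C \<union> T) \<union> Inr ` (- C)" using sub by blast
    have "e \<in> whisker_graph E" using eM M(1) by (rule rev_subsetD)
    then consider d where "d \<in> E" "e = Inl ` d" | x where "e = {Inl x, Inr x}"
      unfolding whisker_graph_def by (elim UnE imageE)
    then show ?thesis
    proof cases
      case 1
      have "x \<in> C" if "x \<in> d" for x using that es noT[of x] 1(2) by auto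
      moreover have "card e = 2" using E 1 unfolding simple_graph_def by (simp add: card_image)
      ultimately show ?thesis using 1(2) by blast
    next
      case 2
      then show ?thesis using es noT by auto
    qed
  qed
  have "2 * card M2 = card (\<Union>M2)"
  proof -
    have "card (\<Union>M2) = (\<Sum>e\<in>M2. card e)"
      by (rule card_Union_disjoint) (use M(2) in \<open>auto simp: M2_def pairwise_def\<close>)
    then show ?thesis using M2 by simp
  qed
  also have "\<dots> \<le> card (Inl ` C :: ('v + 'v) set)" using M2 by (intro card_mono) auto
  also have "\<dots> = card C" by (simp add: card_image)
  finally have "card M2 \<le> card C div 2" by simp
  moreover have "M = M1 \<union> M2" unfolding M2_def M1_def by blast
  then have "card M \<le> card M1 + card M2" by (simp add: card_Un_le)
  ultimately show ?thesis using \<open>card M1 \<le> card T\<close> by linarith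
qed

lemma pairwise_disjnt_Un:
  assumes "pairwise disjnt A" "pairwise disjnt B" "\<And>a b. a \<in> A \<Longrightarrow> b \<in> B \<Longrightarrow> disjnt a b"
  shows "pairwise disjnt (A \<union> B)"
  using assms unfolding pairwise_def by (meson UnE disjnt_sym)

text \<open>There are \<open>CARD('v) - 2 k - 1\<close> vertices outside the cycle, so the bounds on \<open>q\<close> are what is needed
  to choose \<open>q - 1 - k\<close> of them for \<open>T\<close>.\<close>

lemma depth_whisker_odd_cycle_le:
  fixes E :: "'v::finite set set"
  assumes E: "simple_graph E"
    and xs: "distinct xs" "length xs = 2 * k + 1" "closed_walk_edges xs \<subseteq> E"
    and q: "k < q" "q \<le> CARD('v) - k"
  shows "depth_quotient (squarefree_power (whisker_graph E) q :: ('v + 'v, 'k::field) mpoly set)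
    \<le> enat (CARD('v) + q - 1 - k)"
proof -
  define C where "C = set xs"
  have C: "card C = 2 * k + 1" using xs(1,2) by (simp add: C_def distinct_card)
  have le: "2 * k + 1 \<le> CARD('v)" unfolding C[symmetric] by (rule card_mono) auto
  have cC: "card (- C) = CARD('v) - (2 * k + 1)" by (simp add: Compl_eq_Diff_UNIV card_Diff_subset C)
  then have "q - 1 - k \<le> card (- C)" using q le by linarith
  then obtain T where T: "T \<subseteq> - C" "card T = q - 1 - k" by (meson obtain_subset_with_card_n)
  define S :: "('v + 'v) set" where "S = Inl ` (C \<union> T) \<union> Inr ` (- C)"
  have "card S = card (C \<union> T) + card (- C)"
    unfolding S_def by (subst card_Un_disjoint) (auto simp: card_image)
  also have "card (C \<union> T) = card C + card T" using T(1) by (intro card_Un_disjoint) auto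
  finally have card: "card S = CARD('v) + q - 1 - k" using C cC T(2) q le by linarith
  have none: "\<not> contains_matching (whisker_graph E) q S"
  proof
    assume "contains_matching (whisker_graph E) q S"
    then obtain M where M: "M \<subseteq> whisker_graph E" "card M = q" "pairwise disjnt M" "\<Union>M \<subseteq> S"
      unfolding contains_matching_def by blast
    have "card M \<le> card T + card C div 2"
      using card_matching_le[OF M(1,3) E] M(4) unfolding S_def .
    then show False using M(2) T(2) C q by simp
  qed
  have max: "contains_matching (whisker_graph E) q (insert v S)" if v: "v \<notin> S" for v
  proof -
    \<comment> \<open>The whisker at \<open>x\<close> fits into \<open>insert v S\<close>: it consists of \<open>v\<close> and of an element of \<open>S\<close>.\<close>
    define x where "x = (case v of Inl x \<Rightarrow> x | Inr x \<Rightarrow> x)"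
    have xT: "x \<notin> T" using v T(1) unfolding x_def S_def by (cases v) auto
    have whisker: "{Inl x, Inr x} \<subseteq> insert v S" using v unfolding x_def S_def by (cases v) auto
    obtain A where A: "A \<subseteq> E" "finite A" "card A = k" "pairwise disjnt A" "\<Union>A \<subseteq> C - {x}"
      using odd_cycle_matching_avoiding[OF xs, of x] unfolding C_def by blast
    let ?A = "(\<lambda>e. Inl ` e :: ('v + 'v) set) ` A"
    let ?W = "(\<lambda>z. {Inl z, Inr z} :: ('v + 'v) set) ` insert x T"
    have "card ?A = k" using A(3) by (subst card_image) (auto intro!: inj_onI simp: inj_image_eq_iff)
    moreover have "card ?W = Suc (card T)"
      using xT by (subst card_image) (auto intro!: inj_onI simp: doubleton_eq_iff)
    moreover have "?A \<inter> ?W = {}" by auto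
    ultimately have "card (?A \<union> ?W) = q" using T(2) q by (subst card_Un_disjoint) auto
    moreover have "?A \<union> ?W \<subseteq> whisker_graph E" using A(1) unfolding whisker_graph_def by blast
    moreover have "\<Union>(?A \<union> ?W) \<subseteq> insert v S"
      using A(5) whisker T(1) unfolding S_def by auto
    moreover have "pairwise disjnt (?A \<union> ?W)"
    proof -
      have "pairwise disjnt ?A"
        using A(4) unfolding pairwise_image by (auto simp: pairwise_def disjnt_def)
      moreover have "pairwise disjnt ?W" unfolding pairwise_image by (auto simp: pairwise_def disjnt_def)
      moreover have "disjnt a w" if "a \<in> ?A" "w \<in> ?W" for a w
      proof -
        from that(1) obtain d where d: "a = Inl ` d" "d \<in> A" by (rule imageE)
        from that(2) obtain z where z: "w = {Inl z, Inr z}" "z \<in> insert x T" by (rule imageE)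
        have "z \<notin> C - {x}" using z(2) T(1) by auto
        moreover have "d \<subseteq> C - {x}" by (rule order_trans[OF Union_upper[OF d(2)] A(5)])
        ultimately have "z \<notin> d" by (rule contra_subsetD[rotated])
        then show ?thesis unfolding disjnt_def d(1) z(1) by auto
      qed
      ultimately show ?thesis by (rule pairwise_disjnt_Un)
    qed
    ultimately show ?thesis unfolding contains_matching_def
      by (intro exI[of _ "?A \<union> ?W"]) auto
  qed
  show ?thesis using depth_squarefree_power_le[OF none max] unfolding card .
qed

theorem theorem6p2:
  fixes E :: "'v::finite set set" and n m q :: nat
  assumes "simple_graph E" and "unicyclic E"
    and "n = CARD('v)" and "m = unicyclic_girth E" and "odd m"
    and "(m + 1) div 2 \<le> q" and "q \<le> n - m div 2"
  shows "depth_quotient (squarefree_power (whisker_graph E) q :: ('v + 'v, 'k::field) mpoly set)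
           \<le> enat (n + q - 1 - m div 2)"
proof -
  have "\<exists>!C. is_cycle E C" using assms(2) unfolding unicyclic_def by blast
  then have "is_cycle E (THE C. is_cycle E C)" by (rule theI')
  then obtain xs where xs: "distinct xs" "3 \<le> length xs" "closed_walk_edges xs \<subseteq> E"
    and "(THE C. is_cycle E C) = closed_walk_edges xs" unfolding is_cycle_def by auto
  then have m: "m = length xs" using assms(4) card_closed_walk_edges by (simp add: unicyclic_girth_def)
  have "length xs = 2 * (m div 2) + 1" using \<open>odd m\<close> unfolding m by simp
  moreover have "m div 2 < q" using assms(5,6) by (auto elim!: oddE)
  ultimately show ?thesis
    using depth_whisker_odd_cycle_le[OF assms(1) xs(1) _ xs(3), of "m div 2" q] assms(3,7)
    by simp
qed

end
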